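(* Let $\mathcal{I}=\{I_m\}_{m\in\mathbb{N}}$ be a filtration of ideals in a Noetherian ring $R$. For any $x\in R$, the limit $\lim_{n\to\infty}\dfrac{\nu_{\mathcal{I}}(x^n)}{n}$ exists as an element of $\mathbb{R}_{\ge0}\cup\{\infty\}$.
   Context: Rings are commutative with identity, and $\mathbb{N}$ denotes the nonnegative integers. A filtration of a ring $R$ is a family $\mathcal{I} = \{I_m\}_{m\in\mathbb{N}}$ of ideals of $R$ with $I_0 = R$, $I_n \supseteq I_{n+1}$ and $I_n I_m \subseteq I_{n+m}$ for all $m,n \in \mathbb{N}$. The order of $\mathcal{I}$ is $\nu_{\mathcal{I}}(f) = \sup\{m \mid f \in I_m\} \in \mathbb{N}\cup\{\infty\}$ for $f \in R$. *)

theory Defs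
  imports "HOL-Analysis.Analysis" "HOL-Algebra.Algebra"
begin

definition ideal_filtration :: "('a, 'b) ring_scheme \<Rightarrow> (nat \<Rightarrow> 'a set) \<Rightarrow> bool" where
  "ideal_filtration R I \<longleftrightarrow>
     (\<forall>m. ideal (I m) R) \<and>
     I 0 = carrier R \<and>
     (\<forall>n. I (Suc n) \<subseteq> I n) \<and>
     (\<forall>m n. ideal_prod R (I n) (I m) \<subseteq> I (n + m))"

definition filtration_order :: "(nat \<Rightarrow> 'a set) \<Rightarrow> 'a \<Rightarrow> enat" where
  "filtration_order I f = Sup {enat m |m. f \<in> I m}"

end

theory Submission
  imports Defs
begin

text \<open>
  Since \<open>I\<^sub>m I\<^sub>n \<subseteq> I\<^sub>m\<^sub>+\<^sub>n\<close>, the sequence \<open>n \<mapsto> \<nu>(x\<^sup>n)\<close> is superadditive, and Fekete's argument applies to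
  sequences with values in \<open>[0, \<infinity>]\<close> without a separate treatment of \<open>\<infinity>\<close>.
\<close>

text \<open>Induction on \<open>k\<close>. The base case is just nonnegativity of
  \<open>a r\<close>, so the remainder \<open>r\<close> costs nothing; taking
  \<open>k = n div m\<close> and \<open>r = n mod m\<close> bounds \<open>a n\<close> below for
  arbitrary \<open>n\<close>.\<close>

lemma superadditive_mult_le:
  fixes a :: "nat \<Rightarrow> ennreal"
  assumes "\<And>m n. a m + a n \<le> a (m + n)"
  shows "of_nat k * a m \<le> a (k * m + r)"
proof (induction k)
  case (Suc k)
  have "of_nat (Suc k) * a m = a m + of_nat k * a m"
    by (simp add: distrib_right)
  also have "\<dots> \<le> a m + a (k * m + r)"
    using Suc by (rule add_left_mono)
  also have "\<dots> \<le> a (m + (k * m + r))"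
    by (rule assms)
  finally show ?case
    by (simp add: add.assoc)
qed simp

text \<open>Rounding loses at most 1: dividing n/m - 1 \<le> \<open>n div m\<close> \<le> n/m by n
  squeezes the quotient between 1/m - 1/n and 1/m.\<close>

lemma tendsto_div_over_self:
  assumes "m > 0"
  shows "(\<lambda>n. real (n div m) / real n) \<longlonglongrightarrow> 1 / real m"
proof (rule tendsto_sandwich)
  show "\<forall>\<^sub>F n in sequentially. 1 / real m - 1 / real n \<le> real (n div m) / real n"
    using eventually_gt_at_top[of 0]
  proof eventually_elim
    case (elim n)
    have "real n / real m - 1 \<le> real (n div m)"
      by (metis diff_le_eq floor_divide_of_nat_eq of_int_of_nat_eq real_of_int_floor_add_one_ge)
    then have "(real n / real m - 1) / real n \<le> real (n div m) / real n"
      by (intro divide_right_mono) auto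
    then show ?case
      using elim by (simp add: diff_divide_distrib)
  qed
  show "\<forall>\<^sub>F n in sequentially. real (n div m) / real n \<le> 1 / real m"
    using eventually_gt_at_top[of 0]
  proof eventually_elim
    case (elim n)
    have "real (n div m) / real n \<le> real n / real m / real n"
      by (intro divide_right_mono of_nat_div_le_of_nat) auto
    then show ?case
      using elim by simp
  qed
  have "(\<lambda>n. 1 / real m - 1 / real n) \<longlonglongrightarrow> 1 / real m - 0"
    by (intro tendsto_intros lim_1_over_n)
  then show "(\<lambda>n. 1 / real m - 1 / real n) \<longlonglongrightarrow> 1 / real m"
    by simp
qed simp

lemma superadditive_tendsto_SUP:
  fixes a :: "nat \<Rightarrow> ennreal"
  assumes super: "\<And>m n. a m + a n \<le> a (m + n)"
  shows "(\<lambda>n. a n / of_nat n) \<longlonglongrightarrow> (SUP m\<in>{0<..}. a m / of_nat m)"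
proof (rule order_tendstoI)
  fix c assume "c < (SUP m\<in>{0<..}. a m / of_nat m)"
  then obtain m where m: "m > 0" and c: "c < a m / of_nat m"
    by (auto simp: less_SUP_iff)
  \<comment> \<open>The factor 1/m is positive and finite, so the product passes to the limit even
    if \<open>a m\<close> is infinite: the form \<infinity> * 0 does not occur.\<close>
  have "(\<lambda>n. a m * ennreal (real (n div m) / real n)) \<longlonglongrightarrow> a m * ennreal (1 / real m)"
    using m by (intro tendsto_mult_ennreal tendsto_const tendsto_ennrealI tendsto_div_over_self) auto
  moreover have "ennreal (1 / real m) = inverse (of_nat m)"
    using m inverse_ennreal[of "real m"]
    by (simp only: ennreal_of_nat_eq_real_of_nat of_nat_0_less_iff inverse_eq_divide[where 'a=real])
  ultimately have "\<forall>\<^sub>F n in sequentially. c < a m * ennreal (real (n div m) / real n)"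
    using c order_tendstoD(1) unfolding divide_ennreal_def by fastforce
  then show "\<forall>\<^sub>F n in sequentially. c < a n / of_nat n"
    using eventually_gt_at_top[of 0]
  proof eventually_elim
    case (elim n)
    have "ennreal (real (n div m) / real n) = of_nat (n div m) / of_nat n"
      using elim(2) divide_ennreal[of "real (n div m)" "real n"]
      by (simp only: ennreal_of_nat_eq_real_of_nat of_nat_0_le_iff of_nat_0_less_iff)
    then have "a m * ennreal (real (n div m) / real n) = of_nat (n div m) * a m / of_nat n"
      by (simp only: ennreal_times_divide mult.commute)
    also have "\<dots> \<le> a n / of_nat n"
      \<comment> \<open>Division with remainder: \<open>n = n div m * m + n mod m\<close>.\<close>
      using superadditive_mult_le[OF super, of "n div m" m "n mod m"]
      by (intro divide_right_mono_ennreal) simp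
    finally show ?case
      using elim(1) by simp
  qed
next
  fix c assume c: "(SUP m\<in>{0<..}. a m / of_nat m) < c"
  show "\<forall>\<^sub>F n in sequentially. a n / of_nat n < c"
    using eventually_gt_at_top[of 0]
  proof eventually_elim
    \<comment> \<open>For positive \<open>n\<close> the quotient is itself a member of the family
      whose supremum is taken.\<close>
    case (elim n)
    then have "a n / of_nat n \<le> (SUP m\<in>{0<..}. a m / of_nat m)"
      by (intro SUP_upper) simp
    then show ?case
      using c by simp
  qed
qed

text \<open>Testing only finite lower bounds of \<open>a\<close> and \<open>b\<close> covers
  infinite values too: if \<open>c\<close> is some finite \<open>k\<close>, neither summand can
  reach \<open>k + 1\<close>, so both are finite and serve as \<open>p\<close> and \<open>q\<close>
  themselves.\<close>

lemma enat_add_leI: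
  fixes a b c :: enat
  assumes "\<And>p q. enat p \<le> a \<Longrightarrow> enat q \<le> b \<Longrightarrow> enat (p + q) \<le> c"
  shows "a + b \<le> c"
proof (cases c)
  case (enat k)
  have "\<not> enat (Suc k) \<le> a" "\<not> enat (Suc k) \<le> b"
    using assms[of "Suc k" 0] assms[of 0 "Suc k"] enat by (auto simp flip: zero_enat_def)
  then obtain p q where "a = enat p" "b = enat q"
    by (cases a; cases b) auto
  then show ?thesis
    using assms[of p q] by simp
qed simp

text \<open>The ideals descend, so the indices \<open>m\<close> with \<open>f \<in> I m\<close> form
  an initial segment. It contains 0 because \<open>I 0\<close> is the whole ring.\<close>

lemma enat_le_filtration_order_iff:
  assumes "ideal_filtration R I" "f \<in> carrier R"
  shows "enat p \<le> filtration_order I f \<longleftrightarrow> f \<in> I p"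
proof
  assume le: "enat p \<le> filtration_order I f"
  have anti: "I n \<subseteq> I m" if "m \<le> n" for m n
    using assms(1) that unfolding ideal_filtration_def by (metis lift_Suc_antimono_le)
  show "f \<in> I p"
  proof (cases p)
    case 0
    then show ?thesis
      using assms unfolding ideal_filtration_def by simp
  next
    case (Suc k)
    \<comment> \<open>A strict inequality against a supremum yields a member beyond
      \<open>k\<close>, hence at least \<open>p\<close>, even when the supremum is infinite and not
      attained.\<close>
    then have "enat k < filtration_order I f"
      using le by (metis enat_ord_simps(2) lessI order_less_le_trans)
    then obtain m where "f \<in> I m" "k < m"
      by (auto simp: filtration_order_def less_Sup_iff)
    then show ?thesis
      using anti[of p m] Suc by auto
  qed
next
  assume "f \<in> I p"
  then show "enat p \<le> filtration_order I f"
    unfolding filtration_order_def by (intro Sup_upper) auto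
qed

text \<open>Multiplicativity of the filtration: the product lies in the ideal product of
  \<open>I p\<close> and \<open>I q\<close>, hence in \<open>I (p + q)\<close>, for all finite
  \<open>p\<close> and \<open>q\<close> below the two orders.\<close>

lemma filtration_order_add_le_mult:
  assumes "ring R" "ideal_filtration R I" "f \<in> carrier R" "g \<in> carrier R"
  shows "filtration_order I f + filtration_order I g \<le> filtration_order I (f \<otimes>\<^bsub>R\<^esub> g)"
proof (rule enat_add_leI)
  interpret ring R by fact
  fix p q assume "enat p \<le> filtration_order I f" "enat q \<le> filtration_order I g"
  then have "f \<in> I p" "g \<in> I q"
    using assms by (simp_all add: enat_le_filtration_order_iff)
  then have "f \<otimes>\<^bsub>R\<^esub> g \<in> ideal_prod R (I p) (I q)"
    by (rule ideal_prod.prod)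
  also have "\<dots> \<subseteq> I (p + q)"
    using assms(2) unfolding ideal_filtration_def by blast
  finally show "enat (p + q) \<le> filtration_order I (f \<otimes>\<^bsub>R\<^esub> g)"
    using assms by (simp add: enat_le_filtration_order_iff)
qed

theorem theorem3p4:
  fixes R :: "('a, 'b) ring_scheme" (structure)
    and I :: "nat \<Rightarrow> 'a set"
    and x :: 'a
  assumes "cring R"
    and "noetherian_ring R"
    and "ideal_filtration R I"
    and "x \<in> carrier R"
  shows "\<exists>L :: ennreal.
    (\<lambda>n. ennreal_of_enat (filtration_order I (x [^]\<^bsub>R\<^esub> (n :: nat))) / of_nat n)
      \<longlonglongrightarrow> L"
proof -
  interpret cring R by fact
  let ?\<nu> = "\<lambda>n::nat. filtration_order I (x [^]\<^bsub>R\<^esub> n)"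
  have "?\<nu> m + ?\<nu> n \<le> ?\<nu> (m + n)" for m n
    using filtration_order_add_le_mult[OF ring_axioms assms(3), of "x [^]\<^bsub>R\<^esub> m" "x [^]\<^bsub>R\<^esub> n"] assms(4)
    by (simp add: nat_pow_mult)
  \<comment> \<open>The embedding of \<open>enat\<close> into \<open>ennreal\<close> preserves sums
    and reflects and preserves order, so superadditivity carries over to where the quotients
    live.\<close>
  then have "ennreal_of_enat (?\<nu> m) + ennreal_of_enat (?\<nu> n) \<le> ennreal_of_enat (?\<nu> (m + n))" for m n
    by (metis ennreal_of_enat_plus ennreal_of_enat_le_iff)
  from superadditive_tendsto_SUP[where a = "\<lambda>n. ennreal_of_enat (?\<nu> n)", OF this]
  show ?thesis ..
qed

end
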